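(* Let $G=(V,E)$ be a directed graph with $V=\{1,\dots,N\}$ and $E\subseteq V^2$ (self-loops allowed), with adjacency matrix $\mathsf A$. Let $\mathsf H$ be the Hamiltonian path counting matrix of $G$ and let $\mathcal D$ be the set of weakly connected dominating sets in $G$. Then $$\mathsf H=\sum_{D\in\mathcal D}(-1)^{N-|D|}\Big(\mathsf A_D^{N-1}+\frac{\operatorname{Tr}(\mathsf A_D^{N})}{N}\,\mathsf I\Big).$$
   Context: The adjacency matrix $\mathsf A$ is the $N\times N$ matrix with $\mathsf A_{ij}=1$ if $(i,j)\in E$ and $0$ otherwise. $\mathsf I$ is the $N\times N$ identity matrix and $\operatorname{Tr}$ is the trace. For a non-empty $S\subseteq V$, $\mathsf A_S$ is the $N\times N$ matrix with $(\mathsf A_S)_{ij}=\mathsf A_{ij}$ if $i,j\in S$ and $0$ otherwise; $\mathsf A_D^{k}$ denotes the $k$-th power of $\mathsf A_D$. The matrix $\mathsf H$ is the $N\times N$ matrix whose $(i,j)$-entry is the number of Hamiltonian paths from $i$ to $j$: for $i\ne j$, the number of directed simple paths from $i$ to $j$ visiting every vertex of $G$ exactly once (length $N-1$); for $i=j$, the number of directed simple cycles starting and ending at $i$ and visiting every vertex of $G$ (length $N$), with orientation taken into account. Simple paths and cycles are non-empty. A digraph is weakly connected if replacing all its directed edges by undirected edges produces a connected undirected graph. For a non-empty $C\subseteq V$ inducing a weakly connected subgraph, the weak neighborhood is $N(C)=\{i\in V\setminus C:\ \exists j\in C,\ (i,j)\in E\text{ and/or }(j,i)\in E\}$. A weakly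 connected dominating set is a non-empty $D\subseteq V$ such that the subgraph of $G$ induced by $D$ is weakly connected and $|D|+|N(D)|=N$, i.e. $D\cup N(D)=V$.
   Formalization: The identity is stated for N ≥ 2; for N = 1 it always fails, since the right-hand side is 1 plus the number of loops while H counts only the loop, simple paths and cycles being non-empty. *)

theory Defs
  imports "HOL-Analysis.Determinants" "Graph_Theory.Digraph_Component"
begin

text \<open>
  Digraphs are taken from \<^theory>\<open>Graph_Theory.Pair_Digraph\<close>: arcs are ordered pairs of
  vertices, loops are allowed.  Matrices over the index type \<^typ>\<open>'n\<close> are used for digraphs
  whose vertex set is the whole type, so that \<open>N = CARD('n)\<close>.
\<close>

definition adj_matrix :: "'n::finite pair_pre_digraph \<Rightarrow> real^'n^'n" where
  "adj_matrix G = (\<chi> i j. if (i, j) \<in> parcs G then 1 else 0)"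

definition adj_matrix_on :: "'n::finite pair_pre_digraph \<Rightarrow> 'n set \<Rightarrow> real^'n^'n" where
  "adj_matrix_on G S = (\<chi> i j. if i \<in> S \<and> j \<in> S then adj_matrix G $ i $ j else 0)"

text \<open>The type class power \<open>^\<close> on \<^typ>\<open>real^'n^'n\<close> is componentwise, hence:\<close>

primrec matrix_power :: "real^'n^'n \<Rightarrow> nat \<Rightarrow> real^'n^'n" where
  "matrix_power A 0 = mat 1"
| "matrix_power A (Suc k) = A ** matrix_power A k"

text \<open>
  Paths and cycles are arc lists.  For \<open>i \<noteq> j\<close> an \<open>apath\<close> is automatically non-empty, and
  \<open>cycle\<close> requires non-emptiness (a loop is a cycle of length 1).  A cycle from \<open>i\<close> to \<open>i\<close>
  is a list starting at \<open>i\<close>, so each oriented cycle is counted once for the fixed base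
  point \<open>i\<close>.
\<close>

definition hamiltonian_paths ::
    "'a pair_pre_digraph \<Rightarrow> 'a \<Rightarrow> 'a \<Rightarrow> ('a \<times> 'a) awalk set" where
  "hamiltonian_paths G i j =
    (if i \<noteq> j
     then {p. pre_digraph.apath (with_proj G) i p j \<and>
              set (pre_digraph.awalk_verts (with_proj G) i p) = pverts G}
     else {p. pre_digraph.awalk (with_proj G) i p i \<and> pre_digraph.cycle (with_proj G) p \<and>
              set (pre_digraph.awalk_verts (with_proj G) i p) = pverts G})"

definition hamiltonian_matrix :: "'n::finite pair_pre_digraph \<Rightarrow> real^'n^'n" where
  "hamiltonian_matrix G = (\<chi> i j. real (card (hamiltonian_paths G i j)))"

definition weak_neighborhood :: "'a pair_pre_digraph \<Rightarrow> 'a set \<Rightarrow> 'a set" where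
  "weak_neighborhood G C =
    {i \<in> pverts G - C. \<exists>j\<in>C. (i, j) \<in> parcs G \<or> (j, i) \<in> parcs G}"

text \<open>
  \<^const>\<open>Digraph_Component.connected\<close> is weak connectivity: strong connectivity of the
  symmetric closure.
\<close>

definition weakly_connected_dominating_sets :: "'a pair_pre_digraph \<Rightarrow> 'a set set" where
  "weakly_connected_dominating_sets G =
    {D. D \<noteq> {} \<and> D \<subseteq> pverts G \<and> Digraph_Component.connected (with_proj G \<restriction> D) \<and>
        card D + card (weak_neighborhood G D) = card (pverts G)}"

end

theory Submission
  imports Defs
begin

text \<open>
  The matrix powers count walks whose vertices lie in \<open>D\<close>, so after exchanging sums a walk with
  (weakly connected) support \<open>U\<close> is weighted by the alternating sum over all weakly connected
  dominating sets containing \<open>U\<close>.  This weight vanishes unless \<open>U = V\<close>: if \<open>w\<close> is adjacent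
  to \<open>U\<close>, the sets containing \<open>w\<close> are those above \<open>U \<union> {w}\<close>, the remaining ones are exactly
  those above \<open>U\<close> in the graph with \<open>w\<close> deleted, and induction applies to both.  What survives are
  the spanning walks: of length \<open>N - 1\<close> they are the Hamiltonian paths, closed of length \<open>N\<close>
  they are the Hamiltonian cycles, of which there are equally many from every base point.
\<close>

section \<open>Connectedness expressed by cuts\<close>

text \<open>Cuts replace reachability because the later arguments only ever need one edge leaving a
  proper part; \<open>connected_induce_subgraph_iff_linked\<close> ties this form to weak
  connectivity.\<close>

definition linked :: "('a \<Rightarrow> 'a \<Rightarrow> bool) \<Rightarrow> 'a set \<Rightarrow> bool" where
  "linked R S \<longleftrightarrow> S \<noteq> {} \<and> (\<forall>A. A \<noteq> {} \<longrightarrow> A \<subset> S \<longrightarrow> (\<exists>a\<in>A. \<exists>b\<in>S - A. R a b))"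

lemma linked_crossing:
  assumes "linked R S" "A \<noteq> {}" "A \<subset> S"
  obtains a b where "a \<in> A" "b \<in> S - A" "R a b"
  using assms unfolding linked_def by blast

lemma linked_nonempty: "linked R S \<Longrightarrow> S \<noteq> {}"
  unfolding linked_def by (rule conjunct1)

lemma linked_singleton: "linked R {x}"
  unfolding linked_def by blast

text \<open>A cut of \<open>insert w S\<close> either induces a genuine cut of \<open>S\<close>,
  which is crossed already, or separates \<open>w\<close> from all of \<open>S\<close> and is
  crossed by the edge between \<open>a\<close> and \<open>w\<close>, in one of its two
  directions.\<close>

lemma linked_insert:
  assumes "symp R" "linked R S" "a \<in> S" "R a w"
  shows "linked R (insert w S)"
proof (cases "w \<in> S")
  case True
  then show ?thesis using assms(2) by (simp add: insert_absorb)
next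
  case False
  have "\<exists>a\<in>A. \<exists>b\<in>insert w S - A. R a b" if A: "A \<noteq> {}" "A \<subset> insert w S" for A
  proof (cases "A \<inter> S = {} \<or> S \<subseteq> A")
    case True
    then show ?thesis
    proof
      assume "A \<inter> S = {}"
      then have "w \<in> A" "a \<notin> A" using A assms(3) by auto
      moreover have "R w a" using assms(1,4) by (blast dest: sympD)
      ultimately show ?thesis using assms(3) by blast
    next
      assume "S \<subseteq> A"
      then have "a \<in> A" "w \<notin> A" using A assms(3) by auto
      then show ?thesis using assms(4) by blast
    qed
  next
    case False
    then have "A \<inter> S \<noteq> {}" "A \<inter> S \<subset> S" by auto
    then obtain x y where "x \<in> A \<inter> S" "y \<in> S - A \<inter> S" "R x y"
      using linked_crossing[OF assms(2)] by metis
    then show ?thesis by blast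
  qed
  then show ?thesis unfolding linked_def by blast
qed

section \<open>Alternating sums over connected dominating sets\<close>

text \<open>The ambient vertex set \<open>W\<close> is a parameter because the induction deletes
  vertices from it.\<close>

definition linked_dominating_above ::
    "('a \<Rightarrow> 'a \<Rightarrow> bool) \<Rightarrow> 'a set \<Rightarrow> 'a set \<Rightarrow> 'a set set" where
  "linked_dominating_above R W U =
    {H. U \<subseteq> H \<and> H \<subseteq> W \<and> linked R H \<and> (\<forall>w\<in>W - H. \<exists>h\<in>H. R h w)}"

lemma finite_linked_dominating_above:
  "finite W \<Longrightarrow> finite (linked_dominating_above R W U)"
  unfolding linked_dominating_above_def by (rule finite_subset[of _ "Pow W"]) auto

lemma linked_dominating_above_self:
  "linked R U \<Longrightarrow> linked_dominating_above R U U = {U}"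
  unfolding linked_dominating_above_def by auto

text \<open>Splits by whether \<open>w\<close> belongs to the set. If it does not, \<open>w\<close>
  is dominated anyway, through \<open>u\<close>, so deleting it from \<open>W\<close> gives the same
  sets.\<close>

lemma linked_dominating_above_split:
  assumes "u \<in> U" "R u w" "w \<in> W" "w \<notin> U"
  shows "linked_dominating_above R W U =
    linked_dominating_above R W (insert w U) \<union> linked_dominating_above R (W - {w}) U"
proof (intro equalityI subsetI)
  fix H assume "H \<in> linked_dominating_above R W U"
  then show "H \<in> linked_dominating_above R W (insert w U) \<union> linked_dominating_above R (W - {w}) U"
    unfolding linked_dominating_above_def by (cases "w \<in> H") auto
next
  fix H assume "H \<in> linked_dominating_above R W (insert w U) \<union> linked_dominating_above R (W - {w}) U"
  then show "H \<in> linked_dominating_above R W U"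
  proof
    assume "H \<in> linked_dominating_above R (W - {w}) U"
    then show ?thesis
      using assms unfolding linked_dominating_above_def by blast
  qed (auto simp: linked_dominating_above_def)
qed

text \<open>\<open>U\<close> itself dominates nothing outside, and a connected set properly above
  \<open>U\<close> would need an edge leaving \<open>U\<close>.\<close>

lemma linked_dominating_above_isolated:
  assumes "U \<noteq> {}" "U \<subset> W" "\<And>u w. u \<in> U \<Longrightarrow> w \<in> W - U \<Longrightarrow> \<not> R u w"
  shows "linked_dominating_above R W U = {}"
proof -
  have False if H: "H \<in> linked_dominating_above R W U" for H
  proof (cases "H = U")
    case True
    then show False using H assms unfolding linked_dominating_above_def by blast
  next
    case False
    then have "U \<subset> H" "H \<subseteq> W" "linked R H"
      using H unfolding linked_dominating_above_def by auto
    then obtain u w where "u \<in> U" "w \<in> H - U" "R u w"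
      using linked_crossing assms(1) by metis
    then show False using assms(3) \<open>H \<subseteq> W\<close> by blast
  qed
  then show ?thesis by blast
qed

lemma alternating_sum_linked_dominating_above:
  assumes "symp R" "finite W" "U \<subseteq> W" "linked R U"
  shows "(\<Sum>H\<in>linked_dominating_above R W U. (-1) ^ card (W - H)) =
    (if U = W then 1 else 0 :: 'b :: comm_ring_1)"
  using assms
proof (induction "card (W - U)" arbitrary: W U rule: less_induct)
  case less
  show ?case
  proof (cases "U = W")
    case True
    then show ?thesis using less.prems by (simp add: linked_dominating_above_self)
  next
    case False
    have ne: "U \<noteq> {}" using less.prems unfolding linked_def by auto
    show ?thesis
    proof (cases "\<exists>u\<in>U. \<exists>w\<in>W - U. R u w")
      case no: False
      then have "linked_dominating_above R W U = {}"
        using ne False less.prems by (intro linked_dominating_above_isolated) auto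
      then show ?thesis using False by simp
    next
      case True
      then obtain u w where uw: "u \<in> U" "w \<in> W" "w \<notin> U" "R u w" by blast
      let ?A = "linked_dominating_above R W (insert w U)"
      let ?B = "linked_dominating_above R (W - {w}) U"
      have fin: "finite ?A" "finite ?B"
        using less.prems by (auto intro: finite_linked_dominating_above)
      have disj: "?A \<inter> ?B = {}" unfolding linked_dominating_above_def by auto
      have "W - insert w U \<subset> W - U" "W - {w} - U \<subset> W - U" using uw by auto
      then have "card (W - insert w U) < card (W - U)" "card (W - {w} - U) < card (W - U)"
        using less.prems by (simp_all only: psubset_card_mono finite_Diff)
      note IH = less.hyps[OF this(1)] less.hyps[OF this(2)]
      have A: "(\<Sum>H\<in>?A. (-1) ^ card (W - H)) = (if insert w U = W then 1 else 0 :: 'b)"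
        using uw less.prems by (intro IH(1)) (auto intro: linked_insert)
      have B: "(\<Sum>H\<in>?B. (-1) ^ card (W - {w} - H)) = (if U = W - {w} then 1 else 0 :: 'b)"
        using uw less.prems by (intro IH(2)) auto
      \<comment> \<open>Sets in \<open>?B\<close> miss \<open>w\<close>, so deleting
        \<open>w\<close> from the ambient set shortens their complement by one; hence the minus sign
        below.\<close>
      have step: "card (W - H) = Suc (card (W - {w} - H))" if "H \<in> ?B" for H
      proof -
        have "W - H = insert w (W - {w} - H)"
          using that uw unfolding linked_dominating_above_def by auto
        then show ?thesis using less.prems by (metis Diff_iff card_insert_disjoint finite_Diff insertI1)
      qed
      have "(\<Sum>H\<in>linked_dominating_above R W U. (-1) ^ card (W - H)) =
          (\<Sum>H\<in>?A. (-1) ^ card (W - H)) + (\<Sum>H\<in>?B. (-1) ^ card (W - H) :: 'b)"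
        unfolding linked_dominating_above_split[where R = R, OF uw(1,4,2,3)]
        using fin disj by (rule sum.union_disjoint)
      also have "(\<Sum>H\<in>?B. (-1) ^ card (W - H)) = - (\<Sum>H\<in>?B. (-1) ^ card (W - {w} - H) :: 'b)"
        by (simp add: step sum_negf)
      finally have sum: "(\<Sum>H\<in>linked_dominating_above R W U. (-1) ^ card (W - H)) =
          (\<Sum>H\<in>?A. (-1) ^ card (W - H)) + - (\<Sum>H\<in>?B. (-1) ^ card (W - {w} - H) :: 'b)" .
      \<comment> \<open>The two indicators agree and carry opposite signs, so they cancel.\<close>
      have "insert w U = W \<longleftrightarrow> U = W - {w}" using uw by auto
      then show ?thesis unfolding sum A B using False by simp
    qed
  qed
qed

section \<open>Weak connectivity and domination in digraphs\<close>

definition weakly_adjacent :: "'a pair_pre_digraph \<Rightarrow> 'a \<Rightarrow> 'a \<Rightarrow> bool" where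
  "weakly_adjacent G a b \<longleftrightarrow> (a, b) \<in> parcs G \<or> (b, a) \<in> parcs G"

lemma symp_weakly_adjacent: "symp (weakly_adjacent G)"
  unfolding weakly_adjacent_def by (auto intro: sympI)

text \<open>A set that no arc leaves contains everything reachable from it, so an uncrossed cut
  contradicts reachability; conversely, the vertices reachable from \<open>u\<close> form a set that
  no arc leaves, hence all of \<open>D\<close>.\<close>

lemma connected_induce_subgraph_iff_linked:
  "Digraph_Component.connected (with_proj G \<restriction> D) \<longleftrightarrow> linked (weakly_adjacent G) D"
proof -
  let ?M = "mk_symmetric (with_proj G \<restriction> D)"
  have arc: "(a, b) \<in> parcs ?M \<longleftrightarrow> a \<in> D \<and> b \<in> D \<and> weakly_adjacent G a b" for a b
  proof -
    have "(a, b) \<in> parcs ?M \<longleftrightarrow> (\<exists>x y. (x, y) \<in> parcs G \<and> x \<in> D \<and> y \<in> D \<and>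
        (a = x \<and> b = y \<or> a = y \<and> b = x))"
      by (simp add: parcs_mk_symmetric Bex_def conj_assoc)
    then show ?thesis unfolding weakly_adjacent_def by blast
  qed
  show ?thesis
  proof
    assume "Digraph_Component.connected (with_proj G \<restriction> D)"
    then have ne: "D \<noteq> {}" and r: "\<And>u v. u \<in> D \<Longrightarrow> v \<in> D \<Longrightarrow> u \<rightarrow>\<^sup>*\<^bsub>with_proj ?M\<^esub> v"
      unfolding Digraph_Component.connected_def strongly_connected_def by auto
    have "\<exists>a\<in>A. \<exists>b\<in>D - A. weakly_adjacent G a b" if A: "A \<noteq> {}" "A \<subset> D" for A
    proof (rule ccontr)
      assume no: "\<not> ?thesis"
      obtain a b where ab: "a \<in> A" "b \<in> D" "b \<notin> A" using A by blast
      have "a \<rightarrow>\<^sup>*\<^bsub>with_proj ?M\<^esub> b" using r ab A by blast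
      then have "b \<in> A"
        unfolding reachable_def
      proof (induction rule: rtrancl_on_induct)
        case (step x y)
        then show ?case using no arc by auto
      qed (use ab in auto)
      then show False using ab by simp
    qed
    then show "linked (weakly_adjacent G) D" using ne unfolding linked_def by blast
  next
    assume L: "linked (weakly_adjacent G) D"
    have "u \<rightarrow>\<^sup>*\<^bsub>with_proj ?M\<^esub> v" if uv: "u \<in> D" "v \<in> D" for u v
    proof (rule ccontr)
      assume no: "\<not> ?thesis"
      let ?A = "{x \<in> D. u \<rightarrow>\<^sup>*\<^bsub>with_proj ?M\<^esub> x}"
      have "u \<in> ?A" using uv by (auto simp: reachable_def)
      then have ne: "?A \<noteq> {}" by blast
      have "?A \<subset> D" using no uv by auto
      from linked_crossing[OF L ne this]
      obtain a b where ab: "a \<in> ?A" "b \<in> D - ?A" "weakly_adjacent G a b" .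
      then have "(a, b) \<in> parcs ?M" using arc by blast
      then have "u \<rightarrow>\<^sup>*\<^bsub>with_proj ?M\<^esub> b"
        using ab unfolding reachable_def by (auto intro: rtrancl_on_into_rtrancl_on)
      then show False using ab by auto
    qed
    then show "Digraph_Component.connected (with_proj G \<restriction> D)"
      using L linked_nonempty[OF L]
      unfolding Digraph_Component.connected_def strongly_connected_def by simp
  qed
qed

text \<open>\<open>D\<close> and its weak neighborhood are disjoint, so the condition on
  cardinalities says that together they cover all vertices.\<close>

lemma weakly_connected_dominating_sets_above:
  fixes G :: "'n::finite pair_pre_digraph"
  assumes "pverts G = UNIV"
  shows "{D \<in> weakly_connected_dominating_sets G. U \<subseteq> D} =
    linked_dominating_above (weakly_adjacent G) UNIV U"
proof -
  have dom: "card D + card (weak_neighborhood G D) = CARD('n) \<longleftrightarrow>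
      (\<forall>w\<in>UNIV - D. \<exists>h\<in>D. weakly_adjacent G h w)" for D
  proof -
    have "D \<inter> weak_neighborhood G D = {}" unfolding weak_neighborhood_def by auto
    then have "card D + card (weak_neighborhood G D) = card (D \<union> weak_neighborhood G D)"
      by (simp add: card_Un_disjoint)
    also have "\<dots> = CARD('n) \<longleftrightarrow> D \<union> weak_neighborhood G D = UNIV"
      by (metis card_subset_eq finite_class.finite_UNIV subset_UNIV)
    also have "\<dots> \<longleftrightarrow> (\<forall>w\<in>UNIV - D. \<exists>h\<in>D. weakly_adjacent G h w)"
      using assms unfolding weak_neighborhood_def weakly_adjacent_def by blast
    finally show ?thesis .
  qed
  show ?thesis
    unfolding weakly_connected_dominating_sets_def linked_dominating_above_def
      connected_induce_subgraph_iff_linked assms dom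
    by (blast dest: linked_nonempty)
qed

section \<open>Walks as arc lists and the entries of matrix powers\<close>

lemma awalk_with_proj_iff:
  "pverts G = UNIV \<Longrightarrow>
    pre_digraph.awalk (with_proj G) i p j \<longleftrightarrow> set p \<subseteq> parcs G \<and> pcas i p j"
  by (simp add: pre_digraph.awalk_def cas_with_proj_eq)

lemma pcas_append: "pcas i (p @ q) j \<longleftrightarrow> (\<exists>k. pcas i p k \<and> pcas k q j)"
  by (induction p arbitrary: i) auto

lemma pawalk_verts_conv_fst: "pcas i p j \<Longrightarrow> pawalk_verts i p = map fst p @ [j]"
  by (induction p arbitrary: i) auto

lemma pawalk_verts_conv_snd: "pcas i p j \<Longrightarrow> pawalk_verts i p = i # map snd p"
  by (induction p arbitrary: i) auto

definition walks :: "'a pair_pre_digraph \<Rightarrow> nat \<Rightarrow> 'a \<Rightarrow> 'a \<Rightarrow> ('a \<times> 'a) list set" where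
  "walks G k i j = {p. set p \<subseteq> parcs G \<and> pcas i p j \<and> length p = k}"

lemma finite_walks:
  fixes G :: "'n::finite pair_pre_digraph"
  shows "finite (walks G k i j)"
  unfolding walks_def
  by (rule finite_subset[OF _ finite_lists_length_eq[of UNIV k]]) auto

text \<open>Induction on the length, peeling off the first arc. The start must lie in
  \<open>D\<close> for the base case: \<open>mat 1\<close> has ones on the whole diagonal, while the
  empty walk at \<open>i\<close> visits \<open>i\<close>.\<close>

lemma matrix_power_adj_matrix_on_aux:
  fixes G :: "'n::finite pair_pre_digraph"
  assumes "i \<in> D"
  shows "matrix_power (adj_matrix_on G D) k $ i $ j =
    real (card {p \<in> walks G k i j. set (pawalk_verts i p) \<subseteq> D})"
  using assms
proof (induction k arbitrary: i)
  case 0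
  have "{p \<in> walks G 0 i j. set (pawalk_verts i p) \<subseteq> D} = (if i = j then {[]} else {})"
    using 0 by (auto simp: walks_def)
  then show ?case by (simp add: mat_def)
next
  case (Suc k)
  let ?W = "\<lambda>k i. {p \<in> walks G k i j. set (pawalk_verts i p) \<subseteq> D}"
  let ?S = "{l \<in> D. (i, l) \<in> parcs G}"
  have hd: "i \<in> set (pawalk_verts i p)" if "pcas i p j" for i p
    using pawalk_verts_conv_snd[OF that] by simp
  \<comment> \<open>Decomposition by the second vertex \<open>l\<close>; the pieces are disjoint
    because their lists have different heads.\<close>
  have W: "?W (Suc k) i = (\<Union>l\<in>?S. (#) (i, l) ` ?W k l)"
  proof (intro equalityI subsetI)
    fix p assume p: "p \<in> ?W (Suc k) i"
    then obtain e q where "p = e # q" by (cases p) (auto simp: walks_def)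
    moreover obtain a l where "e = (a, l)" by force
    ultimately have "p = (i, l) # q" "q \<in> ?W k l" "l \<in> ?S"
      using p hd[of l q] by (auto simp: walks_def)
    then show "p \<in> (\<Union>l\<in>?S. (#) (i, l) ` ?W k l)" by blast
  next
    fix p assume "p \<in> (\<Union>l\<in>?S. (#) (i, l) ` ?W k l)"
    then show "p \<in> ?W (Suc k) i" using Suc.prems by (auto simp: walks_def)
  qed
  have "card (?W (Suc k) i) = (\<Sum>l\<in>?S. card ((#) (i, l) ` ?W k l))"
    unfolding W by (rule card_UN_disjoint) (auto simp: finite_walks)
  also have "\<dots> = (\<Sum>l\<in>?S. card (?W k l))"
    by (intro sum.cong refl card_image) auto
  finally have "real (card (?W (Suc k) i)) = (\<Sum>l\<in>?S. real (card (?W k l)))" by simp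
  also have "\<dots> = (\<Sum>l\<in>?S. matrix_power (adj_matrix_on G D) k $ l $ j)"
    by (intro sum.cong refl) (simp add: Suc.IH)
  also have "\<dots> = matrix_power (adj_matrix_on G D) (Suc k) $ i $ j"
  proof -
    have "adj_matrix_on G D $ i $ l = (if l \<in> ?S then 1 else 0)" for l
      using Suc.prems by (simp add: adj_matrix_on_def adj_matrix_def)
    then show ?thesis
      by (auto simp: matrix_matrix_mult_def intro!: sum.mono_neutral_cong_left split: if_splits)
  qed
  finally show ?case by simp
qed

text \<open>For \<open>i\<close> outside \<open>D\<close> and a positive exponent both sides are
  zero: row \<open>i\<close> of the matrix vanishes, and every walk from \<open>i\<close> visits
  \<open>i\<close>.\<close>

lemma matrix_power_adj_matrix_on:
  fixes G :: "'n::finite pair_pre_digraph"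
  assumes "k > 0"
  shows "matrix_power (adj_matrix_on G D) k $ i $ j =
    real (card {p \<in> walks G k i j. set (pawalk_verts i p) \<subseteq> D})"
proof (cases "i \<in> D")
  case True
  then show ?thesis by (rule matrix_power_adj_matrix_on_aux)
next
  case False
  obtain m where "k = Suc m" using assms by (cases k) auto
  then have "matrix_power (adj_matrix_on G D) k $ i $ j = 0"
    using False by (simp add: matrix_matrix_mult_def adj_matrix_on_def)
  moreover have "{p \<in> walks G k i j. set (pawalk_verts i p) \<subseteq> D} = {}"
    using False by (auto simp: walks_def pawalk_verts_conv_snd)
  ultimately show ?thesis by (simp only: card.empty of_nat_0)
qed

text \<open>Supplies the connected set \<open>U\<close> to which the alternating sum is applied;
  each arc attaches its tail to the support of the remaining walk.\<close>

lemma linked_pawalk_verts: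
  "set p \<subseteq> parcs G \<Longrightarrow> pcas i p j \<Longrightarrow> linked (weakly_adjacent G) (set (pawalk_verts i p))"
proof (induction p arbitrary: i)
  case Nil
  then show ?case by (simp add: linked_singleton)
next
  case (Cons e p)
  have "snd e \<in> set (pawalk_verts (snd e) p)"
    using Cons.prems pawalk_verts_conv_snd[of "snd e" p j] by simp
  moreover have "weakly_adjacent G (snd e) (fst e)"
    using Cons.prems by (cases e) (auto simp: weakly_adjacent_def)
  ultimately show ?case
    using Cons by (auto intro: linked_insert[OF symp_weakly_adjacent])
qed

lemma alternating_sum_matrix_power:
  fixes G :: "'n::finite pair_pre_digraph"
  assumes "pverts G = UNIV" "k > 0"
  shows "(\<Sum>D\<in>weakly_connected_dominating_sets G.
      (-1) ^ (CARD('n) - card D) * matrix_power (adj_matrix_on G D) k $ i $ j) =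
    real (card {p \<in> walks G k i j. set (pawalk_verts i p) = UNIV})"
proof -
  let ?W = "walks G k i j" and ?V = "\<lambda>p. set (pawalk_verts i p)"
  let ?D = "weakly_connected_dominating_sets G"
  have "(\<Sum>D\<in>?D. (-1) ^ (CARD('n) - card D) * matrix_power (adj_matrix_on G D) k $ i $ j) =
      (\<Sum>D\<in>?D. \<Sum>p\<in>?W. if ?V p \<subseteq> D then (-1) ^ card (UNIV - D) else 0)"
  proof (rule sum.cong[OF refl])
    fix D
    have "(\<Sum>p\<in>?W. if ?V p \<subseteq> D then (-1) ^ card (UNIV - D) else 0) =
        (\<Sum>p\<in>{p \<in> ?W. ?V p \<subseteq> D}. (-1 :: real) ^ card (UNIV - D))"
      by (simp only: sum.inter_filter finite_walks)
    then show "(-1) ^ (CARD('n) - card D) * matrix_power (adj_matrix_on G D) k $ i $ j =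
        (\<Sum>p\<in>?W. if ?V p \<subseteq> D then (-1) ^ card (UNIV - D) else 0)"
      by (simp add: matrix_power_adj_matrix_on[OF assms(2)] card_Diff_subset)
  qed
  also have "\<dots> = (\<Sum>p\<in>?W. \<Sum>D\<in>?D. if ?V p \<subseteq> D then (-1) ^ card (UNIV - D) else 0)"
    by (rule sum.swap)
  also have "\<dots> = (\<Sum>p\<in>?W. if ?V p = UNIV then 1 else 0)"
  proof (rule sum.cong[OF refl])
    fix p assume "p \<in> ?W"
    then have "linked (weakly_adjacent G) (?V p)"
      by (auto simp: walks_def intro: linked_pawalk_verts)
    \<comment> \<open>This is \<open>alternating_sum_linked_dominating_above\<close> with the
      support of \<open>p\<close> as \<open>U\<close> and the whole type as
      \<open>W\<close>.\<close>
    then show "(\<Sum>D\<in>?D. if ?V p \<subseteq> D then (-1) ^ card (UNIV - D) else 0) =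
        (if ?V p = UNIV then 1 else 0 :: real)"
      by (simp add: alternating_sum_linked_dominating_above symp_weakly_adjacent
          weakly_connected_dominating_sets_above[OF assms(1)] flip: sum.inter_filter)
  qed
  also have "\<dots> = real (card {p \<in> ?W. ?V p = UNIV})"
    by (simp add: finite_walks flip: sum.inter_filter)
  finally show ?thesis .
qed

section \<open>Spanning walks as Hamiltonian paths and cycles\<close>

lemma distinct_iff_length_of_set_UNIV:
  fixes xs :: "'n::finite list"
  assumes "set xs = UNIV"
  shows "distinct xs \<longleftrightarrow> length xs = CARD('n)"
  using assms by (metis card_distinct distinct_card)

text \<open>A walk lists one vertex more than it has arcs, so a spanning walk is simple exactly when
  it has \<open>CARD('n) - 1\<close> arcs.\<close>

lemma hamiltonian_paths_eq_walks:
  fixes G :: "'n::finite pair_pre_digraph"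
  assumes "pverts G = UNIV" "i \<noteq> j"
  shows "hamiltonian_paths G i j =
    {p \<in> walks G (CARD('n) - 1) i j. set (pawalk_verts i p) = UNIV}"
proof -
  have "distinct (pawalk_verts i p) \<longleftrightarrow> length p = CARD('n) - 1"
    if "pcas i p j" "set (pawalk_verts i p) = UNIV" for p
  proof -
    have "length (pawalk_verts i p) = Suc (length p)"
      using that(1) by (simp add: pawalk_verts_conv_snd)
    moreover have "CARD('n) > 0" by simp
    ultimately show ?thesis unfolding distinct_iff_length_of_set_UNIV[OF that(2)] by linarith
  qed
  then show ?thesis
    using assms unfolding hamiltonian_paths_def walks_def pre_digraph.apath_def
    by (auto simp: awalk_with_proj_iff awalk_verts_with_proj_eq)
qed

text \<open>Such a walk would list each vertex exactly once, yet it lists \<open>i\<close> at both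
  ends. With at least two vertices the empty walk is excluded. Thus the power \<open>N - 1\<close>
  contributes nothing to the diagonal.\<close>

lemma no_short_covering_closed_walk:
  fixes G :: "'n::finite pair_pre_digraph"
  assumes "CARD('n) \<ge> 2"
  shows "{p \<in> walks G (CARD('n) - 1) i i. set (pawalk_verts i p) = UNIV} = {}"
proof -
  have False if p: "pcas i p i" "length p = CARD('n) - 1" "set (pawalk_verts i p) = UNIV" for p
  proof -
    have "length (pawalk_verts i p) = CARD('n)"
      using p assms by (simp add: pawalk_verts_conv_snd)
    then have "distinct (map fst p @ [i])"
      using p distinct_iff_length_of_set_UNIV pawalk_verts_conv_fst by metis
    moreover have "p \<noteq> []" using p assms by auto
    ultimately show False using p(1) by (cases p) auto
  qed
  then show ?thesis by (auto simp: walks_def)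
qed

text \<open>The base point stands at both ends of the vertex list, so dropping either end loses no
  vertex.\<close>

lemma set_pawalk_verts_closed:
  assumes "pcas i p i" "p \<noteq> []"
  shows "set (pawalk_verts i p) = fst ` set p" "set (pawalk_verts i p) = snd ` set p"
proof -
  have "i \<in> fst ` set p" using assms by (cases p) auto
  then show "set (pawalk_verts i p) = fst ` set p"
    using assms by (auto simp: pawalk_verts_conv_fst)
  have "last (i # map snd p) = last (map fst p @ [i])"
    using assms pawalk_verts_conv_fst pawalk_verts_conv_snd by metis
  then have "last (map snd p) = i" using assms by simp
  then have "i \<in> set (map snd p)" using assms by (metis last_in_set map_is_Nil_conv)
  then show "set (pawalk_verts i p) = snd ` set p"
    using assms by (auto simp: pawalk_verts_conv_snd)
qed

text \<open>A cycle has distinct arc heads. For a spanning closed walk the heads already cover every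
  vertex, so distinctness means having \<open>CARD('n)\<close> arcs.\<close>

lemma hamiltonian_cycles_eq_walks:
  fixes G :: "'n::finite pair_pre_digraph"
  assumes "pverts G = UNIV" "CARD('n) \<ge> 2"
  shows "hamiltonian_paths G i i =
    {p \<in> walks G (CARD('n)) i i. set (pawalk_verts i p) = UNIV}"
proof -
  have key: "(\<exists>u. pcas u p u \<and> distinct (tl (pawalk_verts u p)) \<and> p \<noteq> []) \<longleftrightarrow>
      length p = CARD('n)"
    if p: "pcas i p i" "set (pawalk_verts i p) = UNIV" for p
  proof -
    have ne: "p \<noteq> []"
    proof
      assume "p = []"
      then have "card (set (pawalk_verts i p)) = 1" by simp
      then show False unfolding p(2) using assms(2) by simp
    qed
    \<comment> \<open>\<open>cycle\<close> quantifies its own base point existentially; the first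
      arc of a non-empty list determines it.\<close>
    have u: "u = i" if "pcas u p u" for u
      using that p(1) ne by (cases p) auto
    have "set (map snd p) = UNIV"
      unfolding set_map using set_pawalk_verts_closed(2)[OF p(1) ne] p(2) by (rule subst)
    from distinct_iff_length_of_set_UNIV[OF this]
    have "distinct (tl (pawalk_verts i p)) \<longleftrightarrow> length p = CARD('n)"
      unfolding pawalk_verts_conv_snd[OF p(1)] by simp
    then show ?thesis using p(1) ne u by metis
  qed
  have "hamiltonian_paths G i i =
      {p. (set p \<subseteq> parcs G \<and> pcas i p i) \<and>
        (\<exists>u. (set p \<subseteq> parcs G \<and> pcas u p u) \<and> distinct (tl (pawalk_verts u p)) \<and> p \<noteq> []) \<and>
        set (pawalk_verts i p) = UNIV}"
    unfolding hamiltonian_paths_def pre_digraph.cycle_def awalk_with_proj_iff[OF assms(1)]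
      awalk_verts_with_proj_eq assms(1) by (simp only: simp_thms if_False)
  also have "\<dots> = {p. (set p \<subseteq> parcs G \<and> pcas i p i) \<and>
        (\<exists>u. pcas u p u \<and> distinct (tl (pawalk_verts u p)) \<and> p \<noteq> []) \<and>
        set (pawalk_verts i p) = UNIV}"
    by (intro Collect_cong) blast
  also have "\<dots> = {p. (set p \<subseteq> parcs G \<and> pcas i p i) \<and> length p = CARD('n) \<and>
        set (pawalk_verts i p) = UNIV}"
    using key by (intro Collect_cong) metis
  also have "\<dots> = {p \<in> walks G (CARD('n)) i i. set (pawalk_verts i p) = UNIV}"
    unfolding walks_def by (intro Collect_cong) simp
  finally show ?thesis .
qed

section \<open>Change of base point by rotation\<close>

definition rotate_to :: "'a \<Rightarrow> ('a \<times> 'b) list \<Rightarrow> ('a \<times> 'b) list" where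
  "rotate_to k p = dropWhile (\<lambda>e. fst e \<noteq> k) p @ takeWhile (\<lambda>e. fst e \<noteq> k) p"

lemma rotate_to_append:
  assumes "k \<notin> fst ` set p"
  shows "rotate_to k (p @ (k, x) # q) = (k, x) # q @ p"
proof -
  have "dropWhile (\<lambda>e. fst e \<noteq> k) (p @ (k, x) # q) = (k, x) # q"
    using assms by (induction p) auto
  moreover have "takeWhile (\<lambda>e. fst e \<noteq> k) (p @ (k, x) # q) = p"
    using assms by (induction p) auto
  ultimately show ?thesis unfolding rotate_to_def by simp
qed

text \<open>With \<open>CARD('n)\<close> arcs and all vertices covered, each vertex is the tail of
  exactly one arc, so rotating to the arc out of \<open>k\<close> and then to the arc out of
  \<open>i\<close> restores the list.\<close>

lemma rotate_to_covering_walk: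
  fixes G :: "'n::finite pair_pre_digraph"
  assumes "p \<in> {p \<in> walks G (CARD('n)) i i. set (pawalk_verts i p) = UNIV}"
  shows "rotate_to k p \<in> {p \<in> walks G (CARD('n)) k k. set (pawalk_verts k p) = UNIV}"
    and "rotate_to i (rotate_to k p) = p"
proof -
  have p: "set p \<subseteq> parcs G" "pcas i p i" "length p = CARD('n)" "set (pawalk_verts i p) = UNIV"
    using assms by (auto simp: walks_def)
  then have "p \<noteq> []" by auto
  then have cover: "set (map fst p) = UNIV" using p set_pawalk_verts_closed(1) by fastforce
  then have dist: "distinct (map fst p)"
    using p(3) by (simp add: distinct_iff_length_of_set_UNIV del: set_map)
  obtain a x b where split: "p = a @ (k, x) # b" "k \<notin> fst ` set a"
  proof -
    have "\<exists>e\<in>set p. fst e = k" using cover by (metis UNIV_I imageE list.set_map)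
    from split_list_first_prop[OF this]
    obtain a e b where "p = a @ e # b" "fst e = k" "\<forall>y\<in>set a. fst y \<noteq> k" by blast
    then have "p = a @ (k, snd e) # b" "k \<notin> fst ` set a" by auto
    then show ?thesis by (rule that)
  qed
  then have rot: "rotate_to k p = (k, x) # b @ a" by (simp add: rotate_to_append)
  have walk: "pcas k ((k, x) # b @ a) k"
    using p(2) unfolding split(1) by (auto simp: pcas_append)
  have "fst ` set ((k, x) # b @ a) = UNIV" using cover unfolding split(1) by auto
  then have "set (pawalk_verts k ((k, x) # b @ a)) = UNIV"
    using set_pawalk_verts_closed(1)[OF walk] by simp
  then show "rotate_to k p \<in> {p \<in> walks G (CARD('n)) k k. set (pawalk_verts k p) = UNIV}"
    using p walk unfolding rot by (auto simp: walks_def split(1))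
  show "rotate_to i (rotate_to k p) = p"
  \<comment> \<open>If \<open>a\<close> is empty then \<open>k = i\<close> and nothing moves.
    Otherwise \<open>a\<close> starts with the arc out of \<open>i\<close>, and no arc of
    \<open>(k, x) # b\<close> has tail \<open>i\<close>.\<close>
  proof (cases a)
    case Nil
    then show ?thesis using p(2) split rot by (simp add: rotate_to_def)
  next
    case (Cons f a')
    then obtain y where f: "f = (i, y)" using p(2) split(1) by (cases f) auto
    then have "i \<notin> fst ` set ((k, x) # b)" using dist split(1) Cons by auto
    then have "rotate_to i (((k, x) # b) @ (i, y) # a') = (i, y) # a' @ (k, x) # b"
      by (rule rotate_to_append)
    moreover have "rotate_to k p = ((k, x) # b) @ (i, y) # a'" by (simp add: rot Cons f)
    ultimately show ?thesis by (simp add: split(1) Cons f)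
  qed
qed

text \<open>Makes all diagonal contributions to the trace equal, so that division by
  \<open>N\<close> leaves the count at a single base point.\<close>

lemma card_covering_closed_walks_basepoint:
  fixes G :: "'n::finite pair_pre_digraph"
  shows "card {p \<in> walks G (CARD('n)) i i. set (pawalk_verts i p) = UNIV} =
    card {p \<in> walks G (CARD('n)) k k. set (pawalk_verts k p) = UNIV}"
    (is "card ?I = card ?K")
proof (rule bij_betw_same_card)
  show "bij_betw (rotate_to k) ?I ?K"
  proof (rule bij_betw_byWitness)
    show "\<forall>p\<in>?I. rotate_to i (rotate_to k p) = p"
      by (intro ballI rotate_to_covering_walk(2)) assumption
    show "\<forall>p\<in>?K. rotate_to k (rotate_to i p) = p"
      by (intro ballI rotate_to_covering_walk(2)) assumption
    show "rotate_to k ` ?I \<subseteq> ?K"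
      by (intro image_subsetI rotate_to_covering_walk(1)) assumption
    show "rotate_to i ` ?K \<subseteq> ?I"
      by (intro image_subsetI rotate_to_covering_walk(1)) assumption
  qed
qed

section \<open>Entrywise assembly of the matrix identity\<close>

theorem corollary1:
  fixes G :: "'n::finite pair_pre_digraph" and N :: nat
  assumes "pverts G = UNIV"
    and "N = CARD('n)"
    and "N \<ge> 2"
  shows "hamiltonian_matrix G =
    (\<Sum>D\<in>weakly_connected_dominating_sets G.
      (-1) ^ (N - card D) *\<^sub>R
        (matrix_power (adj_matrix_on G D) (N - 1)
          + (trace (matrix_power (adj_matrix_on G D) N) / real N) *\<^sub>R mat 1))"
proof -
  let ?D = "weakly_connected_dominating_sets G"
  let ?c = "\<lambda>D. (-1 :: real) ^ (N - card D)"
  let ?A = "\<lambda>D. matrix_power (adj_matrix_on G D)"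
  let ?C = "\<lambda>k i j. real (card {p \<in> walks G k i j. set (pawalk_verts i p) = UNIV})"
  have power: "(\<Sum>D\<in>?D. ?c D * ?A D k $ i $ j) = ?C k i j" if "k > 0" for k i j
    using alternating_sum_matrix_power[OF assms(1) that] assms(2) by simp
  have entry: "hamiltonian_matrix G $ i $ j =
      (\<Sum>D\<in>?D. ?c D * (?A D (N - 1) $ i $ j + trace (?A D N) / N * mat 1 $ i $ j))" for i j
  proof -
    have "(\<Sum>D\<in>?D. ?c D * trace (?A D N)) = (\<Sum>l\<in>UNIV. \<Sum>D\<in>?D. ?c D * ?A D N $ l $ l)"
      by (subst sum.swap) (simp add: trace_def sum_distrib_left)
    also have "\<dots> = (\<Sum>l\<in>(UNIV :: 'n set). ?C N i i)"
    \<comment> \<open>Every base point \<open>l\<close> is moved to the fixed row index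
      \<open>i\<close>.\<close>
    proof (rule sum.cong[OF refl])
      fix l
      show "(\<Sum>D\<in>?D. ?c D * ?A D N $ l $ l) = ?C N i i"
        using assms(3) card_covering_closed_walks_basepoint[of G l i]
        by (subst power) (simp_all add: assms(2))
    qed
    also have "\<dots> = N * ?C N i i" by (simp add: assms(2))
    finally have trace: "(\<Sum>D\<in>?D. ?c D * trace (?A D N)) / N = ?C N i i"
      using assms(3) by (simp add: field_simps)
    have "(\<Sum>D\<in>?D. ?c D * (?A D (N - 1) $ i $ j + trace (?A D N) / N * mat 1 $ i $ j)) =
        (\<Sum>D\<in>?D. ?c D * ?A D (N - 1) $ i $ j) +
        (\<Sum>D\<in>?D. ?c D * trace (?A D N)) / N * mat 1 $ i $ j"
      by (simp add: distrib_left sum.distrib sum_distrib_right sum_divide_distrib mult.assoc)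
    \<comment> \<open>Both exponents are positive, \<open>N - 1\<close> because
      \<open>N \<ge> 2\<close>, so \<open>power\<close> applies.\<close>
    also have "\<dots> = ?C (N - 1) i j + ?C N i i * mat 1 $ i $ j"
      using assms(3) by (simp only: trace power)
    also have "\<dots> = hamiltonian_matrix G $ i $ j"
    \<comment> \<open>On the diagonal the first count is zero and the second counts cycles; off the
      diagonal \<open>mat 1\<close> removes the second.\<close>
    proof (cases "i = j")
      case True
      have "?C (N - 1) i i = 0"
        using no_short_covering_closed_walk[of G i] assms(2,3) by (simp only: card.empty of_nat_0)
      then show ?thesis
        using True assms by (simp add: hamiltonian_matrix_def mat_def hamiltonian_cycles_eq_walks)
    next
      case False
      then show ?thesis
        using assms by (simp add: hamiltonian_matrix_def mat_def hamiltonian_paths_eq_walks)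
    qed
    finally show ?thesis by simp
  qed
  show ?thesis
    by (simp add: vec_eq_iff entry)
qed

end
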